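(* Let $e$ be a term of the simply-typed $\lambda$-calculus with numbers, shift and reset. (1) If $\Gamma \vdash_{\mathsf{DF}} e : \tau,\alpha,\beta$, then for every $\mathsf{DF}_2$ type $\gamma$, $$\Gamma^{A,\gamma} \vdash_{\mathsf{DF2}} e : \tau^{A,\gamma}\,\langle \alpha^{A,\gamma}\to\gamma\rangle\,\gamma\,\langle \beta^{A,\gamma}\to\gamma\rangle\,\gamma .$$ (2) If $\Gamma \vdash_{\mathsf{DF2}} e : \tau\,\langle\alpha\to\gamma_1\rangle\,\gamma_2\,\langle\beta\to\gamma_3\rangle\,\gamma_4$, then $$\Gamma^{-A} \vdash_{\mathsf{DF}} e : \tau^{-A},\,\alpha^{-A},\,\beta^{-A}.$$
   Context: Terms: $e ::= n \mid x \mid \lambda x.e \mid e_1e_2 \mid \mathcal{S}k.e$ (shift) $\mid \langle e\rangle$ (reset), $n$ a number. Type environments $\Gamma$ map variables to types of the system at hand. **System $\mathsf{DF}$** (Danvy–Filinski). Types $\tau,\alpha,\beta,\dots ::= \mathbb{N} \mid (\tau_1\to\tau_2),\alpha,\beta$ (a function from $\tau_1$ to $\tau_2$ whose body changes the answer type from $\alpha$ to $\beta$). Judgment $\Gamma\vdash_{\mathsf{DF}}e:\tau,\alpha,\beta$. Rules: - if $x:\tau\in\Gamma$ then $\Gamma\vdash x:\tau,\alpha,\alpha$; and $\Gamma\vdash n:\mathbb{N},\alpha,\alpha$; - if $\Gamma,x:\tau_1\vdash e:\tau_2,\alpha,\beta$ then $\Gamma\vdash\lambda x.e:((\tau_1\to\tau_2),\alpha,\beta),\delta,\delta$;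 - if $\Gamma\vdash e_1:((\tau_1\to\tau_2),\alpha,\beta),\gamma,\delta$ and $\Gamma\vdash e_2:\tau_1,\beta,\gamma$ then $\Gamma\vdash e_1e_2:\tau_2,\alpha,\delta$; - if $\Gamma,k:((\tau\to\alpha),\delta,\delta)\vdash e:\epsilon,\epsilon,\beta$ then $\Gamma\vdash\mathcal{S}k.e:\tau,\alpha,\beta$ (here $\epsilon$ is an arbitrary type); - if $\Gamma\vdash e:\gamma,\gamma,\tau$ then $\Gamma\vdash\langle e\rangle:\tau,\delta,\delta$. **System $\mathsf{DF}_2$.** Types $\tau,\alpha,\beta,\dots ::= \mathbb{N} \mid \tau_1\to\tau_2\,\langle\sigma_\alpha\rangle\,\alpha\,\langle\sigma_\beta\rangle\,\beta$; meta continuation types $\sigma ::= \tau_1\to\tau_2$. Judgment $\Gamma\vdash_{\mathsf{DF2}}e:\tau\langle\sigma_\alpha\rangle\alpha\langle\sigma_\beta\rangle\beta$. Rules: - if $x:\tau\in\Gamma$ then $\Gamma\vdash x:\tau\langle\sigma\rangle\alpha\langle\sigma\rangle\alpha$; and $\Gamma\vdash n:\mathbb{N}\langle\sigma\rangle\alpha\langle\sigma\rangle\alpha$; - if $\Gamma,x:\tau_1\vdash e:\tau_2\langle\sigma_\alpha\rangle\alpha\langle\sigma_\beta\rangle\beta$ then $\Gamma\vdash\lambda x.e:(\tau_1\to\tau_2\langle\sigma_\alpha\rangle\alpha\langle\sigma_\beta\rangle\beta)\langle\sigma_\gamma\rangle\gamma\langle\sigma_\gamma\rangle\gamma$; - if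 $\Gamma\vdash e_1:(\tau_1\to\tau_2\langle\sigma_\alpha\rangle\alpha\langle\sigma_\beta\rangle\beta)\langle\sigma_\gamma\rangle\gamma\langle\sigma_\delta\rangle\delta$ and $\Gamma\vdash e_2:\tau_1\langle\sigma_\beta\rangle\beta\langle\sigma_\gamma\rangle\gamma$ then $\Gamma\vdash e_1e_2:\tau_2\langle\sigma_\alpha\rangle\alpha\langle\sigma_\delta\rangle\delta$; - if $\Gamma,k:\tau\to\tau_1\langle\sigma_1\rangle\tau_2\langle\sigma_1\rangle\alpha\vdash e:\gamma\langle\gamma\to\gamma'\rangle\gamma'\langle\sigma_\beta\rangle\beta$ then $\Gamma\vdash\mathcal{S}k.e:\tau\langle\tau_1\to\tau_2\rangle\alpha\langle\sigma_\beta\rangle\beta$; - if $\Gamma\vdash e:\gamma\langle\gamma\to\gamma'\rangle\gamma'\langle\tau\to\alpha\rangle\beta$ then $\Gamma\vdash\langle e\rangle:\tau\langle\sigma_\alpha\rangle\alpha\langle\sigma_\alpha\rangle\beta$. **Type translations.** For a fixed $\mathsf{DF}_2$ type $\gamma$, from $\mathsf{DF}$ to $\mathsf{DF}_2$: $\mathbb{N}^{A,\gamma}=\mathbb{N}$, $((\tau_1\to\tau_2),\alpha,\beta)^{A,\gamma}=\tau_1^{A,\gamma}\to\tau_2^{A,\gamma}\,\langle\alpha^{A,\gamma}\to\gamma\rangle\,\gamma\,\langle\beta^{A,\gamma}\to\gamma\rangle\,\gamma$. From $\mathsf{DF}_2$ to $\mathsf{DF}$: $\mathbb{N}^{-A}=\mathbb{N}$,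 $(\tau_1\to\tau_2\langle\alpha\to\gamma_1\rangle\gamma_2\langle\beta\to\gamma_3\rangle\gamma_4)^{-A}=(\tau_1^{-A}\to\tau_2^{-A}),\alpha^{-A},\beta^{-A}$. Both are extended pointwise to type environments, written $\Gamma^{A,\gamma}$ and $\Gamma^{-A}$. *)

theory Defs
  imports Main
begin

type_synonym var = string

datatype exp =
    Num nat
  | Var var
  | Lam var exp
  | App exp exp
  | Shift var exp
  | Reset exp

text \<open>\<open>Fun1 \<tau>1 \<tau>2 \<alpha> \<beta>\<close> is the type \<open>(\<tau>1 \<rightarrow> \<tau>2), \<alpha>, \<beta>\<close> of functions from \<open>\<tau>1\<close> to \<open>\<tau>2\<close>
  whose body changes the answer type from \<open>\<alpha>\<close> to \<open>\<beta>\<close>.\<close>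

datatype ty1 =
    Nat1
  | Fun1 ty1 ty1 ty1 ty1

text \<open>An environment extension \<open>\<Gamma>, x : t\<close> is the map update \<open>\<Gamma>(x \<mapsto> t)\<close>, so the
  innermost binding of a variable shadows outer ones.\<close>

inductive df :: "(var \<Rightarrow> ty1 option) \<Rightarrow> exp \<Rightarrow> ty1 \<Rightarrow> ty1 \<Rightarrow> ty1 \<Rightarrow> bool"
    ("_ \<turnstile>\<^sub>D\<^sub>F _ \<Colon> _, _, _" [51, 51, 51, 51, 51] 50) where
  df_var: "\<Gamma> x = Some \<tau> \<Longrightarrow> \<Gamma> \<turnstile>\<^sub>D\<^sub>F Var x \<Colon> \<tau>, \<alpha>, \<alpha>"
| df_num: "\<Gamma> \<turnstile>\<^sub>D\<^sub>F Num n \<Colon> Nat1, \<alpha>, \<alpha>"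
| df_lam: "\<Gamma>(x \<mapsto> \<tau>1) \<turnstile>\<^sub>D\<^sub>F e \<Colon> \<tau>2, \<alpha>, \<beta>
    \<Longrightarrow> \<Gamma> \<turnstile>\<^sub>D\<^sub>F Lam x e \<Colon> Fun1 \<tau>1 \<tau>2 \<alpha> \<beta>, \<delta>, \<delta>"
| df_app: "\<Gamma> \<turnstile>\<^sub>D\<^sub>F e1 \<Colon> Fun1 \<tau>1 \<tau>2 \<alpha> \<beta>, \<gamma>, \<delta> \<Longrightarrow> \<Gamma> \<turnstile>\<^sub>D\<^sub>F e2 \<Colon> \<tau>1, \<beta>, \<gamma>
    \<Longrightarrow> \<Gamma> \<turnstile>\<^sub>D\<^sub>F App e1 e2 \<Colon> \<tau>2, \<alpha>, \<delta>"
| df_shift: "\<Gamma>(k \<mapsto> Fun1 \<tau> \<alpha> \<delta> \<delta>) \<turnstile>\<^sub>D\<^sub>F e \<Colon> \<epsilon>, \<epsilon>, \<beta>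
    \<Longrightarrow> \<Gamma> \<turnstile>\<^sub>D\<^sub>F Shift k e \<Colon> \<tau>, \<alpha>, \<beta>"
| df_reset: "\<Gamma> \<turnstile>\<^sub>D\<^sub>F e \<Colon> \<gamma>, \<gamma>, \<tau> \<Longrightarrow> \<Gamma> \<turnstile>\<^sub>D\<^sub>F Reset e \<Colon> \<tau>, \<delta>, \<delta>"

text \<open>The arrow \<open>\<leadsto>\<close> forms meta continuation types, to keep
  them apart from function types, which use \<open>\<rightarrow>\<close>.\<close>

datatype ty2 =
    Nat2
  | Fun2 ty2 ty2 mty ty2 mty ty2  ("_ \<rightarrow> _ \<langle>_\<rangle> _ \<langle>_\<rangle> _" [61, 61, 0, 61, 0, 61] 60)
and mty =
    Meta ty2 ty2  ("_ \<leadsto> _" [61, 61] 60)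

inductive df2 ::
  "(var \<Rightarrow> ty2 option) \<Rightarrow> exp \<Rightarrow> ty2 \<Rightarrow> mty \<Rightarrow> ty2 \<Rightarrow> mty \<Rightarrow> ty2 \<Rightarrow> bool"
    ("_ \<turnstile>\<^sub>D\<^sub>F\<^sub>2 _ \<Colon> _ \<langle>_\<rangle> _ \<langle>_\<rangle> _" [51, 51, 61, 0, 61, 0, 61] 50) where
  df2_var: "\<Gamma> x = Some \<tau> \<Longrightarrow> \<Gamma> \<turnstile>\<^sub>D\<^sub>F\<^sub>2 Var x \<Colon> \<tau> \<langle>\<sigma>\<rangle> \<alpha> \<langle>\<sigma>\<rangle> \<alpha>"
| df2_num: "\<Gamma> \<turnstile>\<^sub>D\<^sub>F\<^sub>2 Num n \<Colon> Nat2 \<langle>\<sigma>\<rangle> \<alpha> \<langle>\<sigma>\<rangle> \<alpha>"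
| df2_lam: "\<Gamma>(x \<mapsto> \<tau>1) \<turnstile>\<^sub>D\<^sub>F\<^sub>2 e \<Colon> \<tau>2 \<langle>\<sigma>\<alpha>\<rangle> \<alpha> \<langle>\<sigma>\<beta>\<rangle> \<beta>
    \<Longrightarrow> \<Gamma> \<turnstile>\<^sub>D\<^sub>F\<^sub>2 Lam x e \<Colon> (\<tau>1 \<rightarrow> \<tau>2 \<langle>\<sigma>\<alpha>\<rangle> \<alpha> \<langle>\<sigma>\<beta>\<rangle> \<beta>) \<langle>\<sigma>\<gamma>\<rangle> \<gamma> \<langle>\<sigma>\<gamma>\<rangle> \<gamma>"
| df2_app: "\<Gamma> \<turnstile>\<^sub>D\<^sub>F\<^sub>2 e1 \<Colon> (\<tau>1 \<rightarrow> \<tau>2 \<langle>\<sigma>\<alpha>\<rangle> \<alpha> \<langle>\<sigma>\<beta>\<rangle> \<beta>) \<langle>\<sigma>\<gamma>\<rangle> \<gamma> \<langle>\<sigma>\<delta>\<rangle> \<delta>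
    \<Longrightarrow> \<Gamma> \<turnstile>\<^sub>D\<^sub>F\<^sub>2 e2 \<Colon> \<tau>1 \<langle>\<sigma>\<beta>\<rangle> \<beta> \<langle>\<sigma>\<gamma>\<rangle> \<gamma>
    \<Longrightarrow> \<Gamma> \<turnstile>\<^sub>D\<^sub>F\<^sub>2 App e1 e2 \<Colon> \<tau>2 \<langle>\<sigma>\<alpha>\<rangle> \<alpha> \<langle>\<sigma>\<delta>\<rangle> \<delta>"
| df2_shift: "\<Gamma>(k \<mapsto> (\<tau> \<rightarrow> \<tau>1 \<langle>\<sigma>1\<rangle> \<tau>2 \<langle>\<sigma>1\<rangle> \<alpha>)) \<turnstile>\<^sub>D\<^sub>F\<^sub>2 e \<Colon> \<gamma> \<langle>\<gamma> \<leadsto> \<gamma>'\<rangle> \<gamma>' \<langle>\<sigma>\<beta>\<rangle> \<beta>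
    \<Longrightarrow> \<Gamma> \<turnstile>\<^sub>D\<^sub>F\<^sub>2 Shift k e \<Colon> \<tau> \<langle>\<tau>1 \<leadsto> \<tau>2\<rangle> \<alpha> \<langle>\<sigma>\<beta>\<rangle> \<beta>"
| df2_reset: "\<Gamma> \<turnstile>\<^sub>D\<^sub>F\<^sub>2 e \<Colon> \<gamma> \<langle>\<gamma> \<leadsto> \<gamma>'\<rangle> \<gamma>' \<langle>\<tau> \<leadsto> \<alpha>\<rangle> \<beta>
    \<Longrightarrow> \<Gamma> \<turnstile>\<^sub>D\<^sub>F\<^sub>2 Reset e \<Colon> \<tau> \<langle>\<sigma>\<alpha>\<rangle> \<alpha> \<langle>\<sigma>\<alpha>\<rangle> \<beta>"

text \<open>\<open>trA \<gamma> \<tau>\<close> is $\tau^{A,\gamma}$ and \<open>trN \<tau>\<close> is $\tau^{-A}$.\<close>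

primrec trA :: "ty2 \<Rightarrow> ty1 \<Rightarrow> ty2" where
  "trA \<gamma> Nat1 = Nat2"
| "trA \<gamma> (Fun1 \<tau>1 \<tau>2 \<alpha> \<beta>) =
     (trA \<gamma> \<tau>1 \<rightarrow> trA \<gamma> \<tau>2 \<langle>trA \<gamma> \<alpha> \<leadsto> \<gamma>\<rangle> \<gamma> \<langle>trA \<gamma> \<beta> \<leadsto> \<gamma>\<rangle> \<gamma>)"

fun trN :: "ty2 \<Rightarrow> ty1" where
  "trN Nat2 = Nat1"
| "trN (\<tau>1 \<rightarrow> \<tau>2 \<langle>\<alpha> \<leadsto> \<gamma>1\<rangle> \<gamma>2 \<langle>\<beta> \<leadsto> \<gamma>3\<rangle> \<gamma>4) = Fun1 (trN \<tau>1) (trN \<tau>2) (trN \<alpha>) (trN \<beta>)"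

definition trA_env :: "ty2 \<Rightarrow> (var \<Rightarrow> ty1 option) \<Rightarrow> (var \<Rightarrow> ty2 option)" where
  "trA_env \<gamma> \<Gamma> = (\<lambda>x. map_option (trA \<gamma>) (\<Gamma> x))"

definition trN_env :: "(var \<Rightarrow> ty2 option) \<Rightarrow> (var \<Rightarrow> ty1 option)" where
  "trN_env \<Gamma> = (\<lambda>x. map_option trN (\<Gamma> x))"

end

theory Submission imports Defs begin

text \<open>In \<open>df2\<close> the argument type of a meta continuation does the work of the
  answer type of \<open>df\<close>. Fixing every other meta-level type to \<gamma> turns each rule
  of \<open>df\<close> into an instance of the rule of \<open>df2\<close> for the same construct;
  keeping only the argument types (\<open>meta_arg\<close>) turns each rule of \<open>df2\<close>
  into one of \<open>df\<close>. So both directions are inductions on derivations,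
  \<open>df_imp_df2\<close> and \<open>df2_imp_df\<close>.\<close>

lemma trA_env_upd: "trA_env \<gamma> (\<Gamma>(x \<mapsto> \<tau>)) = (trA_env \<gamma> \<Gamma>)(x \<mapsto> trA \<gamma> \<tau>)"
  by (auto simp: trA_env_def)

lemma trN_env_upd: "trN_env (\<Gamma>(x \<mapsto> \<tau>)) = (trN_env \<Gamma>)(x \<mapsto> trN \<tau>)"
  by (auto simp: trN_env_def)

lemma df_imp_df2:
  assumes "\<Gamma> \<turnstile>\<^sub>D\<^sub>F e \<Colon> \<tau>, \<alpha>, \<beta>"
  shows "trA_env \<gamma> \<Gamma> \<turnstile>\<^sub>D\<^sub>F\<^sub>2 e \<Colon>
    trA \<gamma> \<tau> \<langle>trA \<gamma> \<alpha> \<leadsto> \<gamma>\<rangle> \<gamma> \<langle>trA \<gamma> \<beta> \<leadsto> \<gamma>\<rangle> \<gamma>"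
  using assms
proof induction
  case (df_var \<Gamma> x \<tau> \<alpha>)
  then show ?case by (simp add: df2_var trA_env_def)
\<comment> \<open>For shift, \<open>df2_shift\<close> is used with \<open>\<sigma>1\<close> =
  \<open>trA \<gamma> \<delta> \<leadsto> \<gamma>\<close> and with \<open>\<tau>2\<close>,
  \<open>\<alpha>\<close> and \<open>\<gamma>'\<close> all equal to \<gamma>; its
  \<open>\<tau>1\<close> is the translated answer type.\<close>
qed (auto simp: trA_env_upd simp del: fun_upd_apply intro: df2.intros)

primrec meta_arg :: "mty \<Rightarrow> ty2" where
  "meta_arg (\<tau>1 \<leadsto> \<tau>2) = \<tau>1"

text \<open>The equation for \<open>trN\<close> matches on explicit meta continuation types, whereas
  the rules of \<open>df2\<close> have variables there. As \<open>mty\<close> has a single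
  constructor, the projection \<open>meta_arg\<close> covers them all.\<close>

lemma trN_Fun2:
  "trN (\<tau>1 \<rightarrow> \<tau>2 \<langle>\<sigma>\<alpha>\<rangle> \<alpha> \<langle>\<sigma>\<beta>\<rangle> \<beta>)
    = Fun1 (trN \<tau>1) (trN \<tau>2) (trN (meta_arg \<sigma>\<alpha>)) (trN (meta_arg \<sigma>\<beta>))"
  by (cases \<sigma>\<alpha>; cases \<sigma>\<beta>) simp

text \<open>Stated for arbitrary \<open>\<sigma>\<alpha>\<close> and \<open>\<sigma>\<beta>\<close>,
  so that the induction hypotheses fit the rules directly; the claim about
  \<open>\<alpha> \<leadsto> \<gamma>1\<close> and \<open>\<beta> \<leadsto> \<gamma>3\<close> is an
  instance.\<close>

lemma df2_imp_df:
  assumes "\<Gamma> \<turnstile>\<^sub>D\<^sub>F\<^sub>2 e \<Colon> \<tau> \<langle>\<sigma>\<alpha>\<rangle> \<alpha> \<langle>\<sigma>\<beta>\<rangle> \<beta>"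
  shows "trN_env \<Gamma> \<turnstile>\<^sub>D\<^sub>F e \<Colon> trN \<tau>, trN (meta_arg \<sigma>\<alpha>), trN (meta_arg \<sigma>\<beta>)"
  using assms
proof induction
  case (df2_var \<Gamma> x \<tau> \<sigma> \<alpha>)
  then show ?case by (simp add: df_var trN_env_def)
\<comment> \<open>In the shift case the two equal \<open>\<sigma>1\<close> in the type of
  \<open>k\<close> yield the two equal answer types that \<open>df_shift\<close> demands.\<close>
qed (auto simp: trN_env_upd trN_Fun2 simp del: fun_upd_apply intro: df.intros)

theorem theorem5p1:
  fixes e :: exp
  shows "(\<forall>(\<Gamma> :: var \<Rightarrow> ty1 option) \<tau> \<alpha> \<beta>. \<Gamma> \<turnstile>\<^sub>D\<^sub>F e \<Colon> \<tau>, \<alpha>, \<beta> \<longrightarrow>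
            (\<forall>\<gamma> :: ty2. trA_env \<gamma> \<Gamma> \<turnstile>\<^sub>D\<^sub>F\<^sub>2 e \<Colon>
               trA \<gamma> \<tau> \<langle>trA \<gamma> \<alpha> \<leadsto> \<gamma>\<rangle> \<gamma> \<langle>trA \<gamma> \<beta> \<leadsto> \<gamma>\<rangle> \<gamma>))
       \<and> (\<forall>(\<Gamma> :: var \<Rightarrow> ty2 option) \<tau> \<alpha> \<beta> \<gamma>1 \<gamma>2 \<gamma>3 \<gamma>4.
            \<Gamma> \<turnstile>\<^sub>D\<^sub>F\<^sub>2 e \<Colon> \<tau> \<langle>\<alpha> \<leadsto> \<gamma>1\<rangle> \<gamma>2 \<langle>\<beta> \<leadsto> \<gamma>3\<rangle> \<gamma>4 \<longrightarrow>
            trN_env \<Gamma> \<turnstile>\<^sub>D\<^sub>F e \<Colon> trN \<tau>, trN \<alpha>, trN \<beta>)"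
  using df_imp_df2 df2_imp_df by fastforce

end
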